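(* Let $\mathcal{S}=\langle\mathcal{L},\vdash_\gamma\rangle$ and $\mathcal{T}=\langle\mathcal{L}',\vdash_\delta\rangle$ be two propositional deductive systems, with domains $S$ and $T$. If there exists a weak interpretation of $\mathcal{S}$ in $\mathcal{T}$, then there exist a quantale homomorphism $\overline{\tau}:\wp(\mathbf{\Sigma}_{\mathcal{L}})\to\wp(\mathbf{\Sigma}_{\mathcal{L}'})$, a $\wp(\mathbf{\Sigma}_{\mathcal{L}'})$-module structural closure operator $\varepsilon\ge\delta$ on $\wp(\mathbf{T})$, and an injective homomorphism of $\wp(\mathbf{\Sigma}_{\mathcal{L}})$-modules $f:\wp(\mathbf{S})_\gamma\to\wp(\mathbf{T})_\varepsilon$, where $\wp(\mathbf{T})_\varepsilon$ is regarded as a $\wp(\mathbf{\Sigma}_{\mathcal{L}})$-module via $\overline{\tau}$.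
   Context: A propositional language is $\mathcal{L}=\langle L,\nu\rangle$ with $L$ a set of connectives and $\nu:L\to\mathbb{N}_0$ the arity. Fix a denumerable set $V$ of variables common to all languages. $\mathit{Fm}_{\mathcal{L}}$ is the set of $\mathcal{L}$-formulas. A substitution is a map $V\to\mathit{Fm}_{\mathcal{L}}$ extended to formulas; $\mathbf{\Sigma}_{\mathcal{L}}$ is the monoid of substitutions under composition; $\wp(\mathbf{\Sigma}_{\mathcal{L}})$ is the quantale of sets of substitutions (join = union, complex product $\Sigma_1\cdot\Sigma_2=\{\sigma_1\circ\sigma_2\}$, unit $\{\mathrm{id}\}$). A sequent of type $(m,n)$ is a pair of sequences of $\mathcal{L}$-formulas of lengths $m$ and $n$ (not both zero). A set of sequents is assumed closed under type. Formulas are identified with $(0,1)$-sequents, equations with $(1,1)$-sequents. A deductive system $\mathcal{S}=\langle\mathcal{L},\vdash_\gamma\rangle$ has as domain a set $S$ of sequents over $\mathcal{L}$ closed under type, with a finitary, substitution-invariant consequence relation $\vdash_\gamma$ on $\wp(S)$: $\Psi\subseteq\Phi$ implies $\Phi\vdash\Psi$; $\vdash$ is transitive; $\Phi\vdash\bigcup_{\Phi\vdash\Psi}\Psi$; if $\Phi\vdash\Psi$ with $\Psi$ finite then $\Phi_0\vdash\Psi$ for some finite $\Phi_0\subseteq\Phi$; $\Phi\vdash\Psi$ implies $\sigma[\Phi]\vdash\sigma[\Psi]$. The associated closure operator is $\gamma(\Phi)=\bigcup\{\Psi\mid\Phi\vdash_\gamma\Psi\}$. $\wp(\mathbf{S})$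 is the $\wp(\mathbf{\Sigma}_{\mathcal{L}})$-module of subsets of $S$ with $\Sigma\star\Phi=\{\sigma(\varphi)\mid\sigma\in\Sigma,\varphi\in\Phi\}$. A structural closure operator on a $\mathbf{Q}$-module is an order preserving, extensive, idempotent map $\gamma$ with $q\star\gamma(m)\le\gamma(q\star m)$; such operators are compared pointwise. For such $\gamma$, $\wp(\mathbf{S})_\gamma$ is the module $\{\gamma(\Phi)\mid\Phi\subseteq S\}$ with join $\gamma(\bigcup_i\Phi_i)$ and scalar multiplication $\Sigma\star_\gamma\Phi=\gamma(\Sigma\star\Phi)$. An $\mathbf{R}$-module becomes a $\mathbf{Q}$-module via a quantale homomorphism $h:\mathbf{Q}\to\mathbf{R}$ by $q\star_hx=h(q)\star x$. Module homomorphisms preserve arbitrary joins and scalars. Language translation: a derived connective in $\mathcal{L}'$ of arity $n$ is a map $(\psi_1,\dots,\psi_n)\mapsto\varphi(x_1/\psi_1,\dots,x_n/\psi_n)$ for some $\mathcal{L}'$-formula $\varphi(x_1,\dots,x_n)$. Given for each $f\in L$ a derived connective $f'$ in $\mathcal{L}'$ of arity $\nu(f)$, $\tau:\mathit{Fm}_{\mathcal{L}}\to\mathit{Fm}_{\mathcal{L}'}$ is a language translation if $\tau^{-1}(x)=\{x\}$ for every variable $x$ and $\tau(f(\varphi_1,\dots,\varphi_{\nu(f)}))=f'(\tau(\varphi_1),\dots,\tau(\varphi_{\nu(f)}))$. It induces the quantale homomorphism $\overline{\tau}$, the elementwise extension of the map sending $\sigma$ to the substitution whose restriction to $V$ is $\tau\circ\sigma_{\restriction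 V}$. $\mathcal{S}$ is interpretable in $\mathcal{T}$ via $\tau$ if there is a map $\iota:\wp(S)\to\wp(T)$ preserving arbitrary unions such that for all $\Phi,\Psi\subseteq S$ and sets $\Sigma$ of substitutions over $\mathcal{L}$: $\Phi\vdash_\gamma\Psi$ iff $\iota(\Phi)\vdash_\delta\iota(\Psi)$, and $\iota(\Sigma\star\Phi)=\overline{\tau}(\Sigma)\star\iota(\Phi)$. $\mathcal{S}$ is weakly interpretable in $\mathcal{T}$ (there exists a weak interpretation) if there are a language translation $\tau$ of $\mathcal{L}$ in $\mathcal{L}'$ and a non-contradictory extension $\vdash_\varepsilon$ of $\vdash_\delta$ (a consequence relation stronger than $\vdash_\delta$ under which not everything is derivable) such that $\mathcal{S}$ is interpretable via $\tau$ in the deductive system $\mathcal{T}'=\langle\mathcal{L}',\vdash_\varepsilon\rangle$. *)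

theory Defs
  imports "HOL-Algebra.Complete_Lattice"
begin

section \<open>Quantales and their modules\<close>

text \<open>Joins are the suprema \<open>\<Squnion>\<close> of the underlying HOL-Algebra complete lattice; the join of
  the empty family (the bottom element) is included in every distributivity and preservation law.\<close>

record 'a quantale = "'a gorder" +
  qmult :: "'a \<Rightarrow> 'a \<Rightarrow> 'a" (infixl "\<cdot>\<index>" 70)
  qone :: 'a ("\<e>\<index>")

locale quantale = complete_lattice Q for Q :: "('a, 'c) quantale_scheme" (structure) +
  assumes qmult_closed: "\<lbrakk>a \<in> carrier Q; b \<in> carrier Q\<rbrakk> \<Longrightarrow> a \<cdot> b \<in> carrier Q"
    and qone_closed: "\<e> \<in> carrier Q"
    and qmult_assoc: "\<lbrakk>a \<in> carrier Q; b \<in> carrier Q; c \<in> carrier Q\<rbrakk> \<Longrightarrow> (a \<cdot> b) \<cdot> c = a \<cdot> (b \<cdot> c)"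
    and qone_left: "a \<in> carrier Q \<Longrightarrow> \<e> \<cdot> a = a"
    and qone_right: "a \<in> carrier Q \<Longrightarrow> a \<cdot> \<e> = a"
    and qmult_Sup_right: "\<lbrakk>a \<in> carrier Q; B \<subseteq> carrier Q\<rbrakk> \<Longrightarrow> a \<cdot> \<Squnion>B = \<Squnion>((\<lambda>b. a \<cdot> b) ` B)"
    and qmult_Sup_left: "\<lbrakk>a \<in> carrier Q; B \<subseteq> carrier Q\<rbrakk> \<Longrightarrow> \<Squnion>B \<cdot> a = \<Squnion>((\<lambda>b. b \<cdot> a) ` B)"

locale quantale_hom = Q: quantale Q + R: quantale R
  for Q :: "('a, 'c) quantale_scheme" and R :: "('b, 'd) quantale_scheme" and h :: "'a \<Rightarrow> 'b" +
  assumes hom_closed: "h \<in> carrier Q \<rightarrow> carrier R"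
    and hom_Sup: "A \<subseteq> carrier Q \<Longrightarrow> h (\<Squnion>\<^bsub>Q\<^esub>A) = \<Squnion>\<^bsub>R\<^esub>(h ` A)"
    and hom_mult: "\<lbrakk>a \<in> carrier Q; b \<in> carrier Q\<rbrakk> \<Longrightarrow> h (a \<cdot>\<^bsub>Q\<^esub> b) = h a \<cdot>\<^bsub>R\<^esub> h b"
    and hom_one: "h \<e>\<^bsub>Q\<^esub> = \<e>\<^bsub>R\<^esub>"

record ('q, 'x) qmodule = "'x gorder" +
  smult :: "'q \<Rightarrow> 'x \<Rightarrow> 'x" (infixr "\<star>\<index>" 75)

locale quantale_module = Q: quantale Q + M: complete_lattice M
  for Q :: "('q, 'c) quantale_scheme" and M :: "('q, 'x) qmodule" +
  assumes smult_closed: "\<lbrakk>q \<in> carrier Q; x \<in> carrier M\<rbrakk> \<Longrightarrow> q \<star>\<^bsub>M\<^esub> x \<in> carrier M"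
    and smult_assoc: "\<lbrakk>q \<in> carrier Q; r \<in> carrier Q; x \<in> carrier M\<rbrakk>
      \<Longrightarrow> (q \<cdot>\<^bsub>Q\<^esub> r) \<star>\<^bsub>M\<^esub> x = q \<star>\<^bsub>M\<^esub> (r \<star>\<^bsub>M\<^esub> x)"
    and smult_one: "x \<in> carrier M \<Longrightarrow> \<e>\<^bsub>Q\<^esub> \<star>\<^bsub>M\<^esub> x = x"
    and smult_Sup_right: "\<lbrakk>q \<in> carrier Q; X \<subseteq> carrier M\<rbrakk>
      \<Longrightarrow> q \<star>\<^bsub>M\<^esub> \<Squnion>\<^bsub>M\<^esub>X = \<Squnion>\<^bsub>M\<^esub>((\<lambda>x. q \<star>\<^bsub>M\<^esub> x) ` X)"
    and smult_Sup_left: "\<lbrakk>A \<subseteq> carrier Q; x \<in> carrier M\<rbrakk>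
      \<Longrightarrow> (\<Squnion>\<^bsub>Q\<^esub>A) \<star>\<^bsub>M\<^esub> x = \<Squnion>\<^bsub>M\<^esub>((\<lambda>q. q \<star>\<^bsub>M\<^esub> x) ` A)"

locale qmodule_hom = M: quantale_module Q M + N: quantale_module Q N
  for Q :: "('q, 'c) quantale_scheme" and M :: "('q, 'x) qmodule"
    and N :: "('q, 'y) qmodule" and f :: "'x \<Rightarrow> 'y" +
  assumes hom_closed: "f \<in> carrier M \<rightarrow> carrier N"
    and hom_Sup: "X \<subseteq> carrier M \<Longrightarrow> f (\<Squnion>\<^bsub>M\<^esub>X) = \<Squnion>\<^bsub>N\<^esub>(f ` X)"
    and hom_smult: "\<lbrakk>q \<in> carrier Q; x \<in> carrier M\<rbrakk> \<Longrightarrow> f (q \<star>\<^bsub>M\<^esub> x) = q \<star>\<^bsub>N\<^esub> f x"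

text \<open>The \<open>Q\<close>-module obtained from an \<open>R\<close>-module along \<open>h : Q \<rightarrow> R\<close>.\<close>

definition restrict_scalars :: "('q \<Rightarrow> 'r) \<Rightarrow> ('r, 'x) qmodule \<Rightarrow> ('q, 'x) qmodule" where
  "restrict_scalars h N =
    \<lparr>carrier = carrier N, eq = eq N, le = le N, smult = (\<lambda>q x. h q \<star>\<^bsub>N\<^esub> x)\<rparr>"

locale structural_closure_operator = quantale_module Q M
  for Q :: "('q, 'c) quantale_scheme" and M :: "('q, 'x) qmodule" and \<gamma> :: "'x \<Rightarrow> 'x" +
  assumes cl_closed: "\<gamma> \<in> carrier M \<rightarrow> carrier M"
    and cl_mono: "\<lbrakk>x \<in> carrier M; y \<in> carrier M; x \<sqsubseteq>\<^bsub>M\<^esub> y\<rbrakk> \<Longrightarrow> \<gamma> x \<sqsubseteq>\<^bsub>M\<^esub> \<gamma> y"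
    and cl_extensive: "x \<in> carrier M \<Longrightarrow> x \<sqsubseteq>\<^bsub>M\<^esub> \<gamma> x"
    and cl_idem: "x \<in> carrier M \<Longrightarrow> \<gamma> (\<gamma> x) = \<gamma> x"
    and cl_structural: "\<lbrakk>q \<in> carrier Q; x \<in> carrier M\<rbrakk> \<Longrightarrow> q \<star>\<^bsub>M\<^esub> \<gamma> x \<sqsubseteq>\<^bsub>M\<^esub> \<gamma> (q \<star>\<^bsub>M\<^esub> x)"

text \<open>The module \<open>M\<^sub>\<gamma>\<close> of \<open>\<gamma>\<close>-closed elements. Its order is inherited from \<open>M\<close>; the resulting joins
  are \<open>\<gamma> (\<Squnion>\<^bsub>M\<^esub> X)\<close>, see \<open>closed_module_Sup\<close> below.\<close>

definition closed_module :: "('q, 'x) qmodule \<Rightarrow> ('x \<Rightarrow> 'x) \<Rightarrow> ('q, 'x) qmodule" where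
  "closed_module M \<gamma> =
    \<lparr>carrier = \<gamma> ` carrier M, eq = eq M, le = le M, smult = (\<lambda>q x. \<gamma> (q \<star>\<^bsub>M\<^esub> x))\<rparr>"

definition cl_op_le :: "('q, 'x) qmodule \<Rightarrow> ('x \<Rightarrow> 'x) \<Rightarrow> ('x \<Rightarrow> 'x) \<Rightarrow> bool" where
  "cl_op_le M \<gamma> \<delta> \<longleftrightarrow> (\<forall>x \<in> carrier M. \<gamma> x \<sqsubseteq>\<^bsub>M\<^esub> \<delta> x)"


section \<open>Languages, formulas and substitutions\<close>

text \<open>The variables are indexed by the natural numbers, for all languages. The connectives of a
  language form a subset of the type \<open>'f\<close> (possibly empty, finite or infinite).\<close>

record 'f language =
  conns :: "'f set"
  arity :: "'f \<Rightarrow> nat"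

datatype 'f fm = Var nat | App 'f "'f fm list"

inductive_set Fm :: "'f language \<Rightarrow> 'f fm set" for L :: "'f language" where
  Fm_Var: "Var x \<in> Fm L"
| Fm_App: "\<lbrakk>f \<in> conns L; length \<phi>s = arity L f; \<forall>\<phi> \<in> set \<phi>s. \<phi> \<in> Fm L\<rbrakk> \<Longrightarrow> App f \<phi>s \<in> Fm L"

primrec vars :: "'f fm \<Rightarrow> nat set" where
  "vars (Var x) = {x}"
| "vars (App f \<phi>s) = \<Union>(set (map vars \<phi>s))"

text \<open>A substitution is represented by its restriction to the variables.\<close>

type_synonym 'f subst = "nat \<Rightarrow> 'f fm"

primrec app_subst :: "'f subst \<Rightarrow> 'f fm \<Rightarrow> 'f fm" where
  "app_subst \<sigma> (Var x) = \<sigma> x"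
| "app_subst \<sigma> (App f \<phi>s) = App f (map (app_subst \<sigma>) \<phi>s)"

definition Substs :: "'f language \<Rightarrow> 'f subst set" where
  "Substs L = {\<sigma>. range \<sigma> \<subseteq> Fm L}"

definition comp_subst :: "'f subst \<Rightarrow> 'f subst \<Rightarrow> 'f subst" where
  "comp_subst \<sigma> \<rho> = (\<lambda>x. app_subst \<sigma> (\<rho> x))"

definition subst_quantale :: "'f language \<Rightarrow> 'f subst set quantale" where
  "subst_quantale L =
    \<lparr>carrier = Pow (Substs L), eq = (=), le = (\<subseteq>),
     qmult = (\<lambda>\<Sigma>\<^sub>1 \<Sigma>\<^sub>2. {comp_subst \<sigma> \<rho> | \<sigma> \<rho>. \<sigma> \<in> \<Sigma>\<^sub>1 \<and> \<rho> \<in> \<Sigma>\<^sub>2}),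
     qone = {Var}\<rparr>"


section \<open>Sequents and deductive systems\<close>

type_synonym 'f sequent = "'f fm list \<times> 'f fm list"

definition Sequents :: "'f language \<Rightarrow> 'f sequent set" where
  "Sequents L = {(\<Gamma>, \<Delta>). set \<Gamma> \<subseteq> Fm L \<and> set \<Delta> \<subseteq> Fm L \<and> (\<Gamma>, \<Delta>) \<noteq> ([], [])}"

definition seq_type :: "'f sequent \<Rightarrow> nat \<times> nat" where
  "seq_type s = (length (fst s), length (snd s))"

definition closed_under_type :: "'f language \<Rightarrow> 'f sequent set \<Rightarrow> bool" where
  "closed_under_type L S \<longleftrightarrow>
    (\<forall>s \<in> S. \<forall>t \<in> Sequents L. seq_type t = seq_type s \<longrightarrow> t \<in> S)"

definition app_seq :: "'f subst \<Rightarrow> 'f sequent \<Rightarrow> 'f sequent" where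
  "app_seq \<sigma> = map_prod (map (app_subst \<sigma>)) (map (app_subst \<sigma>))"

definition act :: "'f subst set \<Rightarrow> 'f sequent set \<Rightarrow> 'f sequent set" where
  "act \<Sigma> \<Phi> = {app_seq \<sigma> \<phi> | \<sigma> \<phi>. \<sigma> \<in> \<Sigma> \<and> \<phi> \<in> \<Phi>}"

definition sequent_module :: "'f sequent set \<Rightarrow> ('f subst set, 'f sequent set) qmodule" where
  "sequent_module S = \<lparr>carrier = Pow S, eq = (=), le = (\<subseteq>), smult = act\<rparr>"

record 'f dsystem =
  lang :: "'f language"
  sdom :: "'f sequent set"
  entails :: "'f sequent set \<Rightarrow> 'f sequent set \<Rightarrow> bool"

locale deductive_system =
  fixes S :: "'f dsystem"
  assumes dom_sequents: "sdom S \<subseteq> Sequents (lang S)"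
    and dom_closed: "closed_under_type (lang S) (sdom S)"
    and entails_dom: "entails S \<Phi> \<Psi> \<Longrightarrow> \<Phi> \<subseteq> sdom S \<and> \<Psi> \<subseteq> sdom S"
    and entails_subset: "\<lbrakk>\<Phi> \<subseteq> sdom S; \<Psi> \<subseteq> \<Phi>\<rbrakk> \<Longrightarrow> entails S \<Phi> \<Psi>"
    and entails_trans: "\<lbrakk>entails S \<Phi> \<Psi>; entails S \<Psi> \<Xi>\<rbrakk> \<Longrightarrow> entails S \<Phi> \<Xi>"
    and entails_Union: "\<Phi> \<subseteq> sdom S \<Longrightarrow> entails S \<Phi> (\<Union>{\<Psi>. entails S \<Phi> \<Psi>})"
    and entails_finitary: "\<lbrakk>entails S \<Phi> \<Psi>; finite \<Psi>\<rbrakk>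
      \<Longrightarrow> \<exists>\<Phi>\<^sub>0 \<subseteq> \<Phi>. finite \<Phi>\<^sub>0 \<and> entails S \<Phi>\<^sub>0 \<Psi>"
    and entails_subst: "\<lbrakk>entails S \<Phi> \<Psi>; \<sigma> \<in> Substs (lang S)\<rbrakk>
      \<Longrightarrow> entails S (app_seq \<sigma> ` \<Phi>) (app_seq \<sigma> ` \<Psi>)"

definition consequences :: "'f dsystem \<Rightarrow> 'f sequent set \<Rightarrow> 'f sequent set" where
  "consequences S \<Phi> = \<Union>{\<Psi>. entails S \<Phi> \<Psi>}"


section \<open>Translations and interpretations\<close>

text \<open>\<open>d\<close> is the map \<open>(\<psi>\<^sub>1, \<dots>, \<psi>\<^sub>n) \<mapsto> \<phi>(x\<^sub>1/\<psi>\<^sub>1, \<dots>, x\<^sub>n/\<psi>\<^sub>n)\<close> for a formula \<open>\<phi>(x\<^sub>1, \<dots>, x\<^sub>n)\<close>, that is, a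
  formula whose variables are among the pairwise distinct \<open>x\<^sub>1, \<dots>, x\<^sub>n\<close>. The values of
  \<open>\<sigma>\<close> outside these variables are irrelevant.\<close>

definition derived_connective :: "'f language \<Rightarrow> nat \<Rightarrow> ('f fm list \<Rightarrow> 'f fm) \<Rightarrow> bool" where
  "derived_connective L n d \<longleftrightarrow>
    (\<exists>\<phi> xs. \<phi> \<in> Fm L \<and> length xs = n \<and> distinct xs \<and> vars \<phi> \<subseteq> set xs \<and>
      (\<forall>\<psi>s. length \<psi>s = n \<and> set \<psi>s \<subseteq> Fm L \<longrightarrow>
        (\<forall>\<sigma>. (\<forall>i<n. \<sigma> (xs ! i) = \<psi>s ! i) \<longrightarrow> d \<psi>s = app_subst \<sigma> \<phi>)))"

definition language_translation ::
    "'f language \<Rightarrow> 'g language \<Rightarrow> ('f fm \<Rightarrow> 'g fm) \<Rightarrow> bool" where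
  "language_translation L L' \<tau> \<longleftrightarrow>
    \<tau> \<in> Fm L \<rightarrow> Fm L' \<and>
    (\<forall>x. {\<phi> \<in> Fm L. \<tau> \<phi> = Var x} = {Var x}) \<and>
    (\<exists>d. (\<forall>f \<in> conns L. derived_connective L' (arity L f) (d f)) \<and>
         (\<forall>f \<in> conns L. \<forall>\<phi>s. length \<phi>s = arity L f \<and> set \<phi>s \<subseteq> Fm L \<longrightarrow>
            \<tau> (App f \<phi>s) = d f (map \<tau> \<phi>s)))"

definition translate_substs :: "('f fm \<Rightarrow> 'g fm) \<Rightarrow> 'f subst set \<Rightarrow> 'g subst set" where
  "translate_substs \<tau> \<Sigma> = (\<lambda>\<sigma>. \<tau> \<circ> \<sigma>) ` \<Sigma>"

definition interpretable_via :: "'f dsystem \<Rightarrow> 'g dsystem \<Rightarrow> ('f fm \<Rightarrow> 'g fm) \<Rightarrow> bool" where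
  "interpretable_via S T \<tau> \<longleftrightarrow>
    (\<exists>\<iota>. \<iota> \<in> Pow (sdom S) \<rightarrow> Pow (sdom T) \<and>
      (\<forall>X \<subseteq> Pow (sdom S). \<iota> (\<Union>X) = \<Union>(\<iota> ` X)) \<and>
      (\<forall>\<Phi> \<subseteq> sdom S. \<forall>\<Psi> \<subseteq> sdom S. entails S \<Phi> \<Psi> \<longleftrightarrow> entails T (\<iota> \<Phi>) (\<iota> \<Psi>)) \<and>
      (\<forall>\<Sigma> \<subseteq> Substs (lang S). \<forall>\<Phi> \<subseteq> sdom S.
        \<iota> (act \<Sigma> \<Phi>) = act (translate_substs \<tau> \<Sigma>) (\<iota> \<Phi>)))"

text \<open>\<open>E\<close> is an extension of \<open>T\<close>: same language and domain, stronger consequence relation.\<close>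

definition extension_of :: "'f dsystem \<Rightarrow> 'f dsystem \<Rightarrow> bool" where
  "extension_of E T \<longleftrightarrow> deductive_system E \<and> lang E = lang T \<and> sdom E = sdom T \<and>
    (\<forall>\<Phi> \<Psi>. entails T \<Phi> \<Psi> \<longrightarrow> entails E \<Phi> \<Psi>)"

definition non_contradictory :: "'f dsystem \<Rightarrow> bool" where
  "non_contradictory S \<longleftrightarrow> (\<exists>\<phi> \<in> sdom S. \<not> entails S {} {\<phi>})"

definition weakly_interpretable :: "'f dsystem \<Rightarrow> 'g dsystem \<Rightarrow> bool" where
  "weakly_interpretable S T \<longleftrightarrow>
    (\<exists>\<tau> E. language_translation (lang S) (lang T) \<tau> \<and>
      extension_of E T \<and> non_contradictory E \<and> interpretable_via S E \<tau>)"


section \<open>The structures are quantales and modules\<close>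

lemma least_Upper_iff:
  "least L s (Upper L X) \<longleftrightarrow> s \<in> carrier L \<and> (\<forall>x \<in> X \<inter> carrier L. x \<sqsubseteq>\<^bsub>L\<^esub> s) \<and>
    (\<forall>y \<in> carrier L. (\<forall>x \<in> X \<inter> carrier L. x \<sqsubseteq>\<^bsub>L\<^esub> y) \<longrightarrow> s \<sqsubseteq>\<^bsub>L\<^esub> y)"
  by (auto simp: least_def Upper_def)

lemma (in partial_order) Sup_eqI:
  assumes "least L s (Upper L X)"
  shows "\<Squnion>X = s"
  unfolding sup_def using assms by (blast intro: some_equality least_unique)

lemma (in partial_order) complete_lattice_if_sup:
  assumes "\<And>X. X \<subseteq> carrier L \<Longrightarrow> \<exists>s. least L s (Upper L X)"
  shows "complete_lattice L"
proof (rule complete_latticeI)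
  fix X assume X: "X \<subseteq> carrier L"
  obtain i where i: "least L i (Upper L (Lower L X))"
    using assms[of "Lower L X"] by auto
  have "greatest L i (Lower L X)"
    using i X unfolding least_Upper_iff greatest_def Lower_def by auto
  then show "\<exists>i. greatest L i (Lower L X)" ..
qed (use assms in auto)

context structural_closure_operator
begin

lemma closed_module_least:
  assumes "X \<subseteq> carrier (closed_module M \<gamma>)"
  shows "least (closed_module M \<gamma>) (\<gamma> (\<Squnion>\<^bsub>M\<^esub>X)) (Upper (closed_module M \<gamma>) X)"
proof -
  have XM: "X \<subseteq> carrier M"
    using assms cl_closed by (auto simp: closed_module_def)
  then have S: "\<Squnion>\<^bsub>M\<^esub>X \<in> carrier M"
    by simp
  have "x \<sqsubseteq>\<^bsub>M\<^esub> \<gamma> (\<Squnion>\<^bsub>M\<^esub>X)" if "x \<in> X" for x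
    using M.le_trans[OF M.sup_upper[OF XM that] cl_extensive[OF S]] that XM S cl_closed by blast
  moreover have "\<gamma> (\<Squnion>\<^bsub>M\<^esub>X) \<sqsubseteq>\<^bsub>M\<^esub> \<gamma> y"
    if "y \<in> carrier M" "\<forall>x \<in> X. x \<sqsubseteq>\<^bsub>M\<^esub> \<gamma> y" for y
  proof -
    have y: "\<gamma> y \<in> carrier M"
      using that cl_closed by blast
    then have "\<Squnion>\<^bsub>M\<^esub>X \<sqsubseteq>\<^bsub>M\<^esub> \<gamma> y"
      using M.sup_least[OF XM y] that by blast
    then show ?thesis
      using cl_mono[OF S y] cl_idem[OF that(1)] by simp
  qed
  moreover have "X \<inter> \<gamma> ` carrier M = X"
    using assms by (auto simp: closed_module_def)
  ultimately show ?thesis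
    using S by (auto simp: least_Upper_iff closed_module_def)
qed

lemma closed_module_partial_order: "partial_order (closed_module M \<gamma>)"
proof -
  have "\<gamma> x \<in> carrier M" if "x \<in> carrier M" for x
    using that cl_closed by blast
  then show ?thesis
    by unfold_locales
      (auto simp: closed_module_def M.eq_is_equal intro: M.le_antisym M.le_trans)
qed

lemma closed_module_complete_lattice: "complete_lattice (closed_module M \<gamma>)"
  using partial_order.complete_lattice_if_sup[OF closed_module_partial_order] closed_module_least
  by blast

lemma closed_module_Sup:
  assumes "X \<subseteq> carrier (closed_module M \<gamma>)"
  shows "\<Squnion>\<^bsub>closed_module M \<gamma>\<^esub>X = \<gamma> (\<Squnion>\<^bsub>M\<^esub>X)"
  by (rule partial_order.Sup_eqI[OF closed_module_partial_order closed_module_least[OF assms]])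

lemma closed_module_quantale_module: "quantale_module Q (closed_module M \<gamma>)"
proof -
  let ?N = "closed_module M \<gamma>"
  interpret N: complete_lattice ?N
    by (rule closed_module_complete_lattice)
  have cl: "\<gamma> x \<in> carrier M" if "x \<in> carrier M" for x
    using that cl_closed by blast
  have absorb: "\<gamma> (q \<star>\<^bsub>M\<^esub> \<gamma> x) = \<gamma> (q \<star>\<^bsub>M\<^esub> x)" if "q \<in> carrier Q" "x \<in> carrier M" for q x
  proof (rule M.le_antisym)
    show "\<gamma> (q \<star>\<^bsub>M\<^esub> \<gamma> x) \<sqsubseteq>\<^bsub>M\<^esub> \<gamma> (q \<star>\<^bsub>M\<^esub> x)"
      using cl_mono[OF _ _ cl_structural[OF that]] cl_idem that smult_closed cl by metis
    have "q \<star>\<^bsub>M\<^esub> x \<sqsubseteq>\<^bsub>M\<^esub> q \<star>\<^bsub>M\<^esub> \<gamma> x"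
    proof -
      have "q \<star>\<^bsub>M\<^esub> \<Squnion>\<^bsub>M\<^esub>{x, \<gamma> x} = \<Squnion>\<^bsub>M\<^esub>{q \<star>\<^bsub>M\<^esub> x, q \<star>\<^bsub>M\<^esub> \<gamma> x}"
        using smult_Sup_right[of q "{x, \<gamma> x}"] that cl by auto
      moreover have "\<Squnion>\<^bsub>M\<^esub>{x, \<gamma> x} = \<gamma> x"
        by (rule M.Sup_eqI) (use that cl cl_extensive in \<open>auto simp: least_Upper_iff\<close>)
      moreover have "q \<star>\<^bsub>M\<^esub> x \<sqsubseteq>\<^bsub>M\<^esub> \<Squnion>\<^bsub>M\<^esub>{q \<star>\<^bsub>M\<^esub> x, q \<star>\<^bsub>M\<^esub> \<gamma> x}"
        by (rule M.sup_upper) (use that cl smult_closed in auto)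
      ultimately show ?thesis by simp
    qed
    then show "\<gamma> (q \<star>\<^bsub>M\<^esub> x) \<sqsubseteq>\<^bsub>M\<^esub> \<gamma> (q \<star>\<^bsub>M\<^esub> \<gamma> x)"
      by (intro cl_mono) (use that smult_closed cl in auto)
  qed (use that smult_closed cl in auto)
  have Sup_absorb: "\<gamma> (\<Squnion>\<^bsub>M\<^esub>(\<gamma> ` X)) = \<gamma> (\<Squnion>\<^bsub>M\<^esub>X)" if X: "X \<subseteq> carrier M" for X
  proof (rule M.le_antisym)
    have gX: "\<gamma> ` X \<subseteq> carrier M"
      using X cl by blast
    have S: "\<Squnion>\<^bsub>M\<^esub>X \<in> carrier M" "\<Squnion>\<^bsub>M\<^esub>(\<gamma> ` X) \<in> carrier M"
      using X gX by simp_all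
    have "\<gamma> x \<sqsubseteq>\<^bsub>M\<^esub> \<gamma> (\<Squnion>\<^bsub>M\<^esub>X)" if "x \<in> X" for x
      using cl_mono[OF _ S(1) M.sup_upper[OF X that]] that X by blast
    then have "\<Squnion>\<^bsub>M\<^esub>(\<gamma> ` X) \<sqsubseteq>\<^bsub>M\<^esub> \<gamma> (\<Squnion>\<^bsub>M\<^esub>X)"
      using M.sup_least[OF gX cl[OF S(1)]] by blast
    then show "\<gamma> (\<Squnion>\<^bsub>M\<^esub>(\<gamma> ` X)) \<sqsubseteq>\<^bsub>M\<^esub> \<gamma> (\<Squnion>\<^bsub>M\<^esub>X)"
      using cl_mono[OF S(2) cl[OF S(1)]] cl_idem[OF S(1)] by simp
    have "x \<sqsubseteq>\<^bsub>M\<^esub> \<Squnion>\<^bsub>M\<^esub>(\<gamma> ` X)" if "x \<in> X" for x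
    proof -
      have x: "x \<in> carrier M"
        using that X by blast
      show ?thesis
        by (rule M.le_trans[OF cl_extensive[OF x] M.sup_upper[OF gX imageI[OF that]] x cl[OF x] S(2)])
    qed
    then show "\<gamma> (\<Squnion>\<^bsub>M\<^esub>X) \<sqsubseteq>\<^bsub>M\<^esub> \<gamma> (\<Squnion>\<^bsub>M\<^esub>(\<gamma> ` X))"
      using cl_mono[OF S M.sup_least[OF X S(2)]] by blast
    show "\<gamma> (\<Squnion>\<^bsub>M\<^esub>(\<gamma> ` X)) \<in> carrier M" "\<gamma> (\<Squnion>\<^bsub>M\<^esub>X) \<in> carrier M"
      using S cl by auto
  qed
  have smult_N: "q \<star>\<^bsub>?N\<^esub> x = \<gamma> (q \<star>\<^bsub>M\<^esub> x)" for q x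
    by (simp add: closed_module_def)
  have carr_N: "x \<in> carrier ?N \<longleftrightarrow> (\<exists>y \<in> carrier M. x = \<gamma> y)" for x
    by (auto simp: closed_module_def)
  have carr_M: "x \<in> carrier M" if "x \<in> carrier ?N" for x
    using that cl carr_N by auto
  show ?thesis
  proof unfold_locales
    fix q x assume *: "q \<in> carrier Q" "x \<in> carrier ?N"
    show "q \<star>\<^bsub>?N\<^esub> x \<in> carrier ?N"
      using smult_closed[OF *(1) carr_M[OF *(2)]] by (simp add: smult_N closed_module_def)
  next
    fix q r x assume *: "q \<in> carrier Q" "r \<in> carrier Q" "x \<in> carrier ?N"
    then show "(q \<cdot>\<^bsub>Q\<^esub> r) \<star>\<^bsub>?N\<^esub> x = q \<star>\<^bsub>?N\<^esub> (r \<star>\<^bsub>?N\<^esub> x)"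
      using carr_M[OF *(3)] by (simp add: smult_N absorb smult_assoc smult_closed)
  next
    fix x assume "x \<in> carrier ?N"
    then show "\<e>\<^bsub>Q\<^esub> \<star>\<^bsub>?N\<^esub> x = x"
      using carr_M smult_one cl_idem by (auto simp: smult_N carr_N)
  next
    fix q X assume *: "q \<in> carrier Q" "X \<subseteq> carrier ?N"
    then have X: "X \<subseteq> carrier M"
      using carr_M by blast
    have 1: "(\<lambda>x. q \<star>\<^bsub>?N\<^esub> x) ` X = \<gamma> ` ((\<lambda>x. q \<star>\<^bsub>M\<^esub> x) ` X)"
      by (auto simp: smult_N)
    have 2: "(\<lambda>x. q \<star>\<^bsub>M\<^esub> x) ` X \<subseteq> carrier M"
      using X * smult_closed by auto
    have 3: "\<gamma> ` ((\<lambda>x. q \<star>\<^bsub>M\<^esub> x) ` X) \<subseteq> carrier ?N"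
      using 2 unfolding closed_module_def by auto
    show "q \<star>\<^bsub>?N\<^esub> \<Squnion>\<^bsub>?N\<^esub>X = \<Squnion>\<^bsub>?N\<^esub>((\<lambda>x. q \<star>\<^bsub>?N\<^esub> x) ` X)"
      unfolding 1 closed_module_Sup[OF 3] closed_module_Sup[OF *(2)] Sup_absorb[OF 2]
      using X * by (simp add: smult_N absorb smult_Sup_right)
  next
    fix A x assume *: "A \<subseteq> carrier Q" "x \<in> carrier ?N"
    then have x: "x \<in> carrier M"
      using carr_M by blast
    have 1: "(\<lambda>q. q \<star>\<^bsub>?N\<^esub> x) ` A = \<gamma> ` ((\<lambda>q. q \<star>\<^bsub>M\<^esub> x) ` A)"
      by (auto simp: smult_N)
    have 2: "(\<lambda>q. q \<star>\<^bsub>M\<^esub> x) ` A \<subseteq> carrier M"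
      using x * smult_closed by auto
    have 3: "\<gamma> ` ((\<lambda>q. q \<star>\<^bsub>M\<^esub> x) ` A) \<subseteq> carrier ?N"
      using 2 unfolding closed_module_def by auto
    show "(\<Squnion>\<^bsub>Q\<^esub>A) \<star>\<^bsub>?N\<^esub> x = \<Squnion>\<^bsub>?N\<^esub>((\<lambda>q. q \<star>\<^bsub>?N\<^esub> x) ` A)"
      unfolding 1 closed_module_Sup[OF 3] Sup_absorb[OF 2]
      using x * by (simp add: smult_N smult_Sup_left)
  qed
qed

end

lemma powerset_partial_order:
  fixes L :: "('x set, 'z) gorder_scheme"
  assumes "eq L = (=)" "le L = (\<subseteq>)"
  shows "partial_order L"
  by unfold_locales (use assms in auto)

lemma powerset_Sup:
  fixes L :: "('x set, 'z) gorder_scheme"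
  assumes "carrier L = Pow A" "eq L = (=)" "le L = (\<subseteq>)" "X \<subseteq> carrier L"
  shows "\<Squnion>\<^bsub>L\<^esub>X = \<Union>X"
  by (rule partial_order.Sup_eqI[OF powerset_partial_order])
    (use assms in \<open>auto simp: least_Upper_iff Int_absorb2\<close>)

lemma powerset_complete_lattice:
  fixes L :: "('x set, 'z) gorder_scheme"
  assumes "carrier L = Pow A" "eq L = (=)" "le L = (\<subseteq>)"
  shows "complete_lattice L"
proof (rule partial_order.complete_lattice_if_sup[OF powerset_partial_order])
  fix X assume "X \<subseteq> carrier L"
  then have "least L (\<Union>X) (Upper L X)"
    using assms by (auto simp: least_Upper_iff Int_absorb2)
  then show "\<exists>s. least L s (Upper L X)" ..
qed (use assms in auto)

lemma app_subst_Fm: "\<lbrakk>\<phi> \<in> Fm L; \<sigma> \<in> Substs L\<rbrakk> \<Longrightarrow> app_subst \<sigma> \<phi> \<in> Fm L"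
  by (induction rule: Fm.induct) (auto simp: Substs_def intro!: Fm_App)

lemma app_subst_comp: "app_subst (comp_subst \<sigma> \<rho>) \<phi> = app_subst \<sigma> (app_subst \<rho> \<phi>)"
  by (induction \<phi>) (auto simp: comp_subst_def)

lemma app_subst_Var: "app_subst Var \<phi> = \<phi>"
  by (induction \<phi>) (auto simp: map_idI)

lemma comp_subst_closed: "\<lbrakk>\<sigma> \<in> Substs L; \<rho> \<in> Substs L\<rbrakk> \<Longrightarrow> comp_subst \<sigma> \<rho> \<in> Substs L"
  unfolding Substs_def[of L] comp_subst_def
  by (auto intro!: app_subst_Fm simp: Substs_def)

lemma comp_subst_assoc: "comp_subst (comp_subst \<sigma> \<rho>) \<theta> = comp_subst \<sigma> (comp_subst \<rho> \<theta>)"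
  unfolding comp_subst_def[of _ \<theta>] app_subst_comp by (simp add: comp_subst_def)

lemma comp_subst_Var: "comp_subst Var \<sigma> = \<sigma>" "comp_subst \<sigma> Var = \<sigma>"
  by (simp_all add: comp_subst_def app_subst_Var)

lemma subst_quantale_Sup: "X \<subseteq> Pow (Substs L) \<Longrightarrow> \<Squnion>\<^bsub>subst_quantale L\<^esub>X = \<Union>X"
  by (rule powerset_Sup) (auto simp: subst_quantale_def)

lemma quantale_subst_quantale: "quantale (subst_quantale L)"
proof -
  let ?Q = "subst_quantale L"
  interpret complete_lattice ?Q
    by (rule powerset_complete_lattice) (auto simp: subst_quantale_def)
  have carr: "carrier ?Q = Pow (Substs L)"
    by (simp add: subst_quantale_def)
  have mult: "A \<cdot>\<^bsub>?Q\<^esub> B = {comp_subst \<sigma> \<rho> | \<sigma> \<rho>. \<sigma> \<in> A \<and> \<rho> \<in> B}" for A B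
    by (simp add: subst_quantale_def)
  have mult_closed: "A \<cdot>\<^bsub>?Q\<^esub> B \<subseteq> Substs L" if "A \<subseteq> Substs L" "B \<subseteq> Substs L" for A B
    using that by (auto simp: mult intro!: comp_subst_closed)
  show ?thesis
  proof unfold_locales
    fix a B assume *: "a \<in> carrier ?Q" "B \<subseteq> carrier ?Q"
    have "(\<lambda>b. a \<cdot>\<^bsub>?Q\<^esub> b) ` B \<subseteq> Pow (Substs L)" "(\<lambda>b. b \<cdot>\<^bsub>?Q\<^esub> a) ` B \<subseteq> Pow (Substs L)"
      using mult_closed * unfolding carr by blast+
    moreover have "B \<subseteq> Pow (Substs L)"
      using * carr by simp
    ultimately show "a \<cdot>\<^bsub>?Q\<^esub> \<Squnion>\<^bsub>?Q\<^esub>B = \<Squnion>\<^bsub>?Q\<^esub>((\<lambda>b. a \<cdot>\<^bsub>?Q\<^esub> b) ` B)"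
      "\<Squnion>\<^bsub>?Q\<^esub>B \<cdot>\<^bsub>?Q\<^esub> a = \<Squnion>\<^bsub>?Q\<^esub>((\<lambda>b. b \<cdot>\<^bsub>?Q\<^esub> a) ` B)"
      by (simp_all add: subst_quantale_Sup) (auto simp: mult)
  next
    fix a b c
    show "a \<cdot>\<^bsub>?Q\<^esub> b \<cdot>\<^bsub>?Q\<^esub> c = a \<cdot>\<^bsub>?Q\<^esub> (b \<cdot>\<^bsub>?Q\<^esub> c)"
      unfolding mult by (blast intro: comp_subst_assoc comp_subst_assoc[symmetric])
  next
    fix a b assume "a \<in> carrier ?Q" "b \<in> carrier ?Q"
    then show "a \<cdot>\<^bsub>?Q\<^esub> b \<in> carrier ?Q"
      using mult_closed by (simp add: carr)
  qed (auto simp: subst_quantale_def comp_subst_Var Substs_def intro: Fm.intros)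
qed

lemma app_seq_comp: "app_seq (comp_subst \<sigma> \<rho>) s = app_seq \<sigma> (app_seq \<rho> s)"
  by (cases s) (simp add: app_seq_def app_subst_comp)

lemma app_seq_Var: "app_seq Var s = s"
  by (cases s) (simp add: app_seq_def app_subst_Var map_idI)

lemma sequent_module_Sup: "X \<subseteq> Pow S \<Longrightarrow> \<Squnion>\<^bsub>sequent_module S\<^esub>X = \<Union>X"
  by (rule powerset_Sup) (auto simp: sequent_module_def)

context deductive_system
begin

lemma app_seq_dom:
  assumes "s \<in> sdom S" "\<sigma> \<in> Substs (lang S)"
  shows "app_seq \<sigma> s \<in> sdom S"
proof -
  have "app_seq \<sigma> s \<in> Sequents (lang S)"
    using assms dom_sequents app_subst_Fm by (cases s) (fastforce simp: Sequents_def app_seq_def)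
  moreover have "seq_type (app_seq \<sigma> s) = seq_type s"
    by (cases s) (simp add: seq_type_def app_seq_def)
  ultimately show ?thesis
    using assms dom_closed unfolding closed_under_type_def by blast
qed

lemma act_closed: "\<lbrakk>\<Sigma> \<subseteq> Substs (lang S); \<Phi> \<subseteq> sdom S\<rbrakk> \<Longrightarrow> act \<Sigma> \<Phi> \<subseteq> sdom S"
  unfolding act_def using app_seq_dom by blast

lemma quantale_module_sequent_module:
  "quantale_module (subst_quantale (lang S)) (sequent_module (sdom S))"
proof -
  let ?Q = "subst_quantale (lang S)" and ?M = "sequent_module (sdom S)"
  interpret Q: quantale ?Q
    by (rule quantale_subst_quantale)
  interpret M: complete_lattice ?M
    by (rule powerset_complete_lattice) (auto simp: sequent_module_def)
  have carrQ: "carrier ?Q = Pow (Substs (lang S))"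
    by (simp add: subst_quantale_def)
  have carrM: "carrier ?M = Pow (sdom S)"
    by (simp add: sequent_module_def)
  have mult: "q \<cdot>\<^bsub>?Q\<^esub> r = {comp_subst \<sigma> \<rho> | \<sigma> \<rho>. \<sigma> \<in> q \<and> \<rho> \<in> r}" for q r
    by (simp add: subst_quantale_def)
  have smult: "q \<star>\<^bsub>?M\<^esub> x = act q x" for q x
    by (simp add: sequent_module_def)
  show ?thesis
  proof unfold_locales
    fix q x assume "q \<in> carrier ?Q" "x \<in> carrier ?M"
    then show "q \<star>\<^bsub>?M\<^esub> x \<in> carrier ?M"
      using act_closed by (simp add: carrQ carrM smult)
  next
    fix q r x assume "q \<in> carrier ?Q" "r \<in> carrier ?Q" "x \<in> carrier ?M"
    show "(q \<cdot>\<^bsub>?Q\<^esub> r) \<star>\<^bsub>?M\<^esub> x = q \<star>\<^bsub>?M\<^esub> (r \<star>\<^bsub>?M\<^esub> x)"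
      unfolding smult mult act_def by (blast intro: app_seq_comp app_seq_comp[symmetric])
  next
    fix x
    show "\<e>\<^bsub>?Q\<^esub> \<star>\<^bsub>?M\<^esub> x = x"
      by (auto simp: smult act_def subst_quantale_def app_seq_Var)
  next
    fix q X assume *: "q \<in> carrier ?Q" "X \<subseteq> carrier ?M"
    then have "(\<lambda>x. q \<star>\<^bsub>?M\<^esub> x) ` X \<subseteq> Pow (sdom S)"
      using act_closed unfolding carrQ carrM smult by blast
    with * show "q \<star>\<^bsub>?M\<^esub> \<Squnion>\<^bsub>?M\<^esub>X = \<Squnion>\<^bsub>?M\<^esub>((\<lambda>x. q \<star>\<^bsub>?M\<^esub> x) ` X)"
      by (simp add: sequent_module_Sup carrM) (auto simp: smult act_def)
  next
    fix A x assume *: "A \<subseteq> carrier ?Q" "x \<in> carrier ?M"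
    then have "(\<lambda>q. q \<star>\<^bsub>?M\<^esub> x) ` A \<subseteq> Pow (sdom S)"
      using act_closed unfolding carrQ carrM smult by blast
    with * show "(\<Squnion>\<^bsub>?Q\<^esub>A) \<star>\<^bsub>?M\<^esub> x = \<Squnion>\<^bsub>?M\<^esub>((\<lambda>q. q \<star>\<^bsub>?M\<^esub> x) ` A)"
      by (simp add: sequent_module_Sup subst_quantale_Sup carrQ) (auto simp: smult act_def)
  qed
qed

lemma entails_consequences: "\<Phi> \<subseteq> sdom S \<Longrightarrow> entails S \<Phi> (consequences S \<Phi>)"
  using entails_Union by (simp add: consequences_def)

lemma consequences_dom: "consequences S \<Phi> \<subseteq> sdom S"
  using entails_dom by (auto simp: consequences_def)

lemma entails_iff:
  assumes "\<Phi> \<subseteq> sdom S"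
  shows "entails S \<Phi> \<Psi> \<longleftrightarrow> \<Psi> \<subseteq> consequences S \<Phi>"
  using entails_trans[OF entails_consequences[OF assms] entails_subset[OF consequences_dom]]
  by (auto simp: consequences_def)

lemma structural_closure_operator_consequences:
  "structural_closure_operator (subst_quantale (lang S)) (sequent_module (sdom S)) (consequences S)"
proof -
  let ?Q = "subst_quantale (lang S)" and ?M = "sequent_module (sdom S)"
  interpret quantale_module ?Q ?M
    by (rule quantale_module_sequent_module)
  have ext: "\<Phi> \<subseteq> consequences S \<Phi>" if "\<Phi> \<subseteq> sdom S" for \<Phi>
    using that entails_subset[OF that] entails_iff by blast
  have cut: "consequences S \<Phi> \<subseteq> consequences S \<Psi>" if "\<Phi> \<subseteq> consequences S \<Psi>" "\<Psi> \<subseteq> sdom S" for \<Phi> \<Psi>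
  proof -
    have "\<Phi> \<subseteq> sdom S"
      using that(1) consequences_dom by blast
    then have "entails S \<Psi> (consequences S \<Phi>)"
      using entails_trans[OF _ entails_consequences] that entails_iff[OF that(2)] by blast
    then show ?thesis
      using entails_iff[OF that(2)] by blast
  qed
  have str: "act \<Sigma> (consequences S \<Phi>) \<subseteq> consequences S (act \<Sigma> \<Phi>)"
    if "\<Sigma> \<subseteq> Substs (lang S)" "\<Phi> \<subseteq> sdom S" for \<Sigma> \<Phi>
  proof -
    have "app_seq \<sigma> ` consequences S \<Phi> \<subseteq> consequences S (act \<Sigma> \<Phi>)" if "\<sigma> \<in> \<Sigma>" for \<sigma>
    proof -
      have s: "\<sigma> \<in> Substs (lang S)"
        using that \<open>\<Sigma> \<subseteq> _\<close> by blast
      have a: "act \<Sigma> \<Phi> \<subseteq> sdom S"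
        using act_closed \<open>\<Sigma> \<subseteq> _\<close> \<open>\<Phi> \<subseteq> _\<close> by blast
      have "app_seq \<sigma> ` \<Phi> \<subseteq> act \<Sigma> \<Phi>"
        using that by (auto simp: act_def)
      then have "entails S (act \<Sigma> \<Phi>) (app_seq \<sigma> ` consequences S \<Phi>)"
        by (rule entails_trans[OF entails_subset[OF a]
              entails_subst[OF entails_consequences[OF \<open>\<Phi> \<subseteq> _\<close>] s]])
      then show ?thesis
        by (simp only: entails_iff[OF a])
    qed
    then show ?thesis
      unfolding act_def[of \<Sigma> "consequences S \<Phi>"] by blast
  qed
  have idem: "consequences S (consequences S \<Phi>) = consequences S \<Phi>" if "\<Phi> \<subseteq> sdom S" for \<Phi>
    using cut[OF subset_refl that] ext[OF consequences_dom] by (rule subset_antisym)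
  have mono: "consequences S \<Phi> \<subseteq> consequences S \<Psi>" if "\<Phi> \<subseteq> \<Psi>" "\<Psi> \<subseteq> sdom S" for \<Phi> \<Psi>
    using cut[OF _ that(2)] ext[OF that(2)] that(1) by blast
  have carrQ: "carrier ?Q = Pow (Substs (lang S))"
    by (simp add: subst_quantale_def)
  have M: "carrier ?M = Pow (sdom S)" "le ?M = (\<subseteq>)" "smult ?M = act"
    by (simp_all add: sequent_module_def)
  show ?thesis
  proof (intro structural_closure_operator.intro quantale_module_axioms
      structural_closure_operator_axioms.intro)
    show "consequences S \<in> carrier ?M \<rightarrow> carrier ?M"
      using consequences_dom by (simp add: M)
  qed (simp_all only: carrQ M Pow_iff, (rule mono ext idem str; assumption)+)
qed

end

end

theory Submission
  imports Defs
begin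

text \<open>If \<open>\<iota>\<close> interprets \<open>\<S>\<close> in an extension of \<open>\<T>\<close> with closure operator \<open>\<epsilon>\<close>, the required embedding is
  \<open>\<epsilon> \<circ> \<iota>\<close> restricted to the theories of \<open>\<S>\<close>. That \<open>\<iota>\<close> preserves entailment gives
  \<open>\<epsilon> (\<iota> (\<gamma> \<Phi>)) = \<epsilon> (\<iota> \<Phi>)\<close>, so joins and scalars pass through \<open>\<epsilon> \<circ> \<iota>\<close>; that it reflects entailment gives
  injectivity. Scalars are translated along \<open>\<sigma> \<mapsto> \<tau> \<circ> \<sigma>\<close>, which is multiplicative since
  \<open>\<tau> (\<sigma> \<phi>) = (\<tau> \<circ> \<sigma>) (\<tau> \<phi>)\<close>: derived connectives commute with substitutions.\<close>

section \<open>The quantale homomorphism induced by a translation\<close>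

lemma derived_connective_subst:
  assumes d: "derived_connective L n d"
    and \<psi>s: "length \<psi>s = n" "set \<psi>s \<subseteq> Fm L"
    and \<sigma>: "\<sigma> \<in> Substs L"
  shows "app_subst \<sigma> (d \<psi>s) = d (map (app_subst \<sigma>) \<psi>s)"
proof -
  obtain \<phi> xs where xs: "length xs = n" "distinct xs"
    and eq: "\<And>\<psi>s \<rho>. \<lbrakk>length \<psi>s = n; set \<psi>s \<subseteq> Fm L; \<And>i. i < n \<Longrightarrow> \<rho> (xs ! i) = \<psi>s ! i\<rbrakk>
      \<Longrightarrow> d \<psi>s = app_subst \<rho> \<phi>"
    using d unfolding derived_connective_def by blast
  \<comment> \<open>Distinctness of \<open>xs\<close> makes the lookup return
    \<open>\<psi>s ! i\<close> at \<open>xs ! i\<close>. The values of \<open>\<rho>\<close> outside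
    \<open>xs\<close> are unspecified, which is harmless since the defining property of
    \<open>d\<close> constrains a substitution on \<open>xs\<close> alone.\<close>
  define \<rho> where "\<rho> x = the (map_of (zip xs \<psi>s) x)" for x
  have \<rho>: "\<rho> (xs ! i) = \<psi>s ! i" if "i < n" for i
    using that xs \<psi>s by (simp add: \<rho>_def map_of_zip_nth)
  \<comment> \<open>The composite sends \<open>xs ! i\<close> to the \<sigma>-instance of
    \<open>\<psi>s ! i\<close>, so it is an admissible substitution for evaluating \<open>d\<close>
    at the substituted arguments.\<close>
  have "d (map (app_subst \<sigma>) \<psi>s) = app_subst (comp_subst \<sigma> \<rho>) \<phi>"
  proof (rule eq)
    show "set (map (app_subst \<sigma>) \<psi>s) \<subseteq> Fm L"
      using \<psi>s(2) app_subst_Fm[OF _ \<sigma>] by auto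
  qed (use \<psi>s(1) \<rho> in \<open>simp_all add: comp_subst_def\<close>)
  moreover have "d \<psi>s = app_subst \<rho> \<phi>"
    by (rule eq[OF \<psi>s \<rho>])
  ultimately show ?thesis
    by (simp add: app_subst_comp)
qed

text \<open>Induction on the formula. At an application, the induction hypothesis identifies the
  translated arguments, and the derived connective \<open>d f\<close> commutes with the substitution
  \<open>\<tau> \<circ> \<sigma>\<close>.\<close>

lemma language_translation_subst:
  assumes \<tau>: "language_translation L L' \<tau>" and "\<phi> \<in> Fm L" and \<sigma>: "\<sigma> \<in> Substs L"
  shows "\<tau> (app_subst \<sigma> \<phi>) = app_subst (\<tau> \<circ> \<sigma>) (\<tau> \<phi>)"
proof -
  obtain d where d: "\<And>f. f \<in> conns L \<Longrightarrow> derived_connective L' (arity L f) (d f)"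
    and eq: "\<And>f \<phi>s. \<lbrakk>f \<in> conns L; length \<phi>s = arity L f; set \<phi>s \<subseteq> Fm L\<rbrakk>
      \<Longrightarrow> \<tau> (App f \<phi>s) = d f (map \<tau> \<phi>s)"
    using \<tau> unfolding language_translation_def by blast
  have Fm: "\<tau> \<phi> \<in> Fm L'" if "\<phi> \<in> Fm L" for \<phi>
    using \<tau> that unfolding language_translation_def by blast
  have Var: "\<tau> (Var x) = Var x" for x
    using \<tau> unfolding language_translation_def by blast
  have \<sigma>': "\<tau> \<circ> \<sigma> \<in> Substs L'"
    using \<sigma> Fm by (auto simp: Substs_def)
  show ?thesis
    using \<open>\<phi> \<in> Fm L\<close>
  proof induction
    case (Fm_Var x)
    then show ?case
      by (simp add: Var)
  next
    case (Fm_App f \<phi>s)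
    then have sub: "set \<phi>s \<subseteq> Fm L"
      by blast
    then have sub': "set (map (app_subst \<sigma>) \<phi>s) \<subseteq> Fm L" "set (map \<tau> \<phi>s) \<subseteq> Fm L'"
      using app_subst_Fm[OF _ \<sigma>] Fm by auto
    have "\<tau> (app_subst \<sigma> (App f \<phi>s)) = d f (map \<tau> (map (app_subst \<sigma>) \<phi>s))"
      using eq[OF Fm_App(1) _ sub'(1)] Fm_App(2) by simp
    also have "map \<tau> (map (app_subst \<sigma>) \<phi>s) = map (app_subst (\<tau> \<circ> \<sigma>)) (map \<tau> \<phi>s)"
      using Fm_App by (simp add: o_def)
    also have "d f \<dots> = app_subst (\<tau> \<circ> \<sigma>) (d f (map \<tau> \<phi>s))"
      using derived_connective_subst[OF d[OF Fm_App(1)] _ sub'(2) \<sigma>'] Fm_App(2) by simp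
    finally show ?case
      by (simp only: eq[OF Fm_App(1,2) sub])
  qed
qed

lemma translate_substs_closed:
  assumes "language_translation L L' \<tau>" "\<Sigma> \<subseteq> Substs L"
  shows "translate_substs \<tau> \<Sigma> \<subseteq> Substs L'"
proof -
  have "\<tau> \<in> Fm L \<rightarrow> Fm L'"
    using assms(1) by (simp add: language_translation_def)
  then show ?thesis
    using assms(2) by (auto simp: translate_substs_def Substs_def Pi_iff image_subset_iff subset_iff)
qed

lemma quantale_hom_translate_substs:
  assumes \<tau>: "language_translation L L' \<tau>"
  shows "quantale_hom (subst_quantale L) (subst_quantale L') (translate_substs \<tau>)"
proof (intro quantale_hom.intro quantale_subst_quantale quantale_hom_axioms.intro)
  let ?Q = "subst_quantale L" and ?R = "subst_quantale L'" and ?h = "translate_substs \<tau>"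
  show "?h \<in> carrier ?Q \<rightarrow> carrier ?R"
    using translate_substs_closed[OF \<tau>] by (simp add: subst_quantale_def)
  show "?h (\<Squnion>\<^bsub>?Q\<^esub>A) = \<Squnion>\<^bsub>?R\<^esub>(?h ` A)" if "A \<subseteq> carrier ?Q" for A
  proof -
    have A: "A \<subseteq> Pow (Substs L)"
      using that by (simp add: subst_quantale_def)
    then have "?h ` A \<subseteq> Pow (Substs L')"
      using translate_substs_closed[OF \<tau>] by blast
    with A show ?thesis
      by (simp add: subst_quantale_Sup) (auto simp: translate_substs_def)
  qed
  show "?h (a \<cdot>\<^bsub>?Q\<^esub> b) = ?h a \<cdot>\<^bsub>?R\<^esub> ?h b" if "a \<in> carrier ?Q" "b \<in> carrier ?Q" for a b
  proof -
    have "\<tau> \<circ> comp_subst \<sigma> \<rho> = comp_subst (\<tau> \<circ> \<sigma>) (\<tau> \<circ> \<rho>)" if "\<sigma> \<in> a" "\<rho> \<in> b" for \<sigma> \<rho>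
    proof
      fix x
      have "\<sigma> \<in> Substs L" "\<rho> x \<in> Fm L"
        using that \<open>a \<in> _\<close> \<open>b \<in> _\<close> by (auto simp: subst_quantale_def Substs_def subset_iff image_subset_iff)
      then show "(\<tau> \<circ> comp_subst \<sigma> \<rho>) x = comp_subst (\<tau> \<circ> \<sigma>) (\<tau> \<circ> \<rho>) x"
        using language_translation_subst[OF \<tau>] by (simp add: comp_subst_def)
    qed
    \<comment> \<open>Both complex products are written as images of \<open>a \<times> b\<close>, so
      the pointwise identity just proved carries over to sets.\<close>
    then have "(\<lambda>(\<sigma>, \<rho>). \<tau> \<circ> comp_subst \<sigma> \<rho>) ` (a \<times> b)
        = (\<lambda>(\<sigma>, \<rho>). comp_subst (\<tau> \<circ> \<sigma>) (\<tau> \<circ> \<rho>)) ` (a \<times> b)"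
      by (intro image_cong) auto
    moreover have "?h (a \<cdot>\<^bsub>?Q\<^esub> b) = (\<lambda>(\<sigma>, \<rho>). \<tau> \<circ> comp_subst \<sigma> \<rho>) ` (a \<times> b)"
      by (auto simp: subst_quantale_def translate_substs_def)
    moreover have "?h a \<cdot>\<^bsub>?R\<^esub> ?h b = (\<lambda>(\<sigma>, \<rho>). comp_subst (\<tau> \<circ> \<sigma>) (\<tau> \<circ> \<rho>)) ` (a \<times> b)"
      by (auto simp: subst_quantale_def translate_substs_def)
    ultimately show ?thesis
      by simp
  qed
  have "\<tau> (Var x) = Var x" for x
    using \<tau> unfolding language_translation_def by blast
  then have "\<tau> \<circ> Var = Var"
    by (simp add: fun_eq_iff)
  then show "?h \<e>\<^bsub>?Q\<^esub> = \<e>\<^bsub>?R\<^esub>"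
    by (simp add: subst_quantale_def translate_substs_def)
qed

section \<open>Restriction of scalars\<close>

lemma restrict_scalars_simps:
  "carrier (restrict_scalars h N) = carrier N"
  "eq (restrict_scalars h N) = eq N"
  "le (restrict_scalars h N) = le N"
  "smult (restrict_scalars h N) q = smult N (h q)"
  by (simp_all add: restrict_scalars_def)

text \<open>Least upper bounds depend on carrier and order only, and restriction of scalars keeps
  both; hence joins and completeness carry over from \<open>N\<close>.\<close>

lemma least_restrict_scalars:
  "least (restrict_scalars h N) s (Upper (restrict_scalars h N) X) \<longleftrightarrow> least N s (Upper N X)"
  by (simp add: least_Upper_iff restrict_scalars_simps)

lemma restrict_scalars_Sup: "\<Squnion>\<^bsub>restrict_scalars h N\<^esub>X = \<Squnion>\<^bsub>N\<^esub>X"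
  by (simp add: sup_def least_restrict_scalars)

lemma restrict_scalars_quantale_module:
  assumes "quantale_hom Q R h" "quantale_module R N"
  shows "quantale_module Q (restrict_scalars h N)"
proof -
  interpret h: quantale_hom Q R h by fact
  interpret N: quantale_module R N by fact
  let ?N = "restrict_scalars h N"
  have h: "h q \<in> carrier R" if "q \<in> carrier Q" for q
    using that h.hom_closed by blast
  have "partial_order ?N"
    by unfold_locales
      (auto simp: restrict_scalars_simps N.M.eq_is_equal intro: N.M.le_antisym N.M.le_trans)
  then interpret L: complete_lattice ?N
  proof (rule partial_order.complete_lattice_if_sup)
    fix X assume "X \<subseteq> carrier ?N"
    then show "\<exists>s. least ?N s (Upper ?N X)"
      using N.M.sup_exists[of X] by (auto simp: least_restrict_scalars restrict_scalars_simps)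
  qed
  show ?thesis
  proof unfold_locales
    fix q X assume "q \<in> carrier Q" "X \<subseteq> carrier ?N"
    then show "q \<star>\<^bsub>?N\<^esub> \<Squnion>\<^bsub>?N\<^esub>X = \<Squnion>\<^bsub>?N\<^esub>((\<lambda>x. q \<star>\<^bsub>?N\<^esub> x) ` X)"
      using h by (simp add: restrict_scalars_Sup restrict_scalars_simps N.smult_Sup_right)
  next
    fix A x assume *: "A \<subseteq> carrier Q" "x \<in> carrier ?N"
    then have "h ` A \<subseteq> carrier R"
      using h by blast
    with * show "(\<Squnion>\<^bsub>Q\<^esub>A) \<star>\<^bsub>?N\<^esub> x = \<Squnion>\<^bsub>?N\<^esub>((\<lambda>q. q \<star>\<^bsub>?N\<^esub> x) ` A)"
      by (simp add: restrict_scalars_Sup restrict_scalars_simps h.hom_Sup N.smult_Sup_left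
          image_image)
  qed (simp_all add: restrict_scalars_simps h h.hom_mult h.hom_one
      N.smult_closed N.smult_assoc N.smult_one)
qed

section \<open>Consequence closures and the module of theories\<close>

context deductive_system
begin

text \<open>By transitivity, interderivable sets have the same consequences. The identities between
  closures below are reduced to two entailments in this way.\<close>

lemma consequences_eqI:
  assumes "entails S \<Phi> \<Psi>" "entails S \<Psi> \<Phi>"
  shows "consequences S \<Phi> = consequences S \<Psi>"
  unfolding consequences_def using assms entails_trans by blast

lemma consequences_extensive: "\<Phi> \<subseteq> sdom S \<Longrightarrow> \<Phi> \<subseteq> consequences S \<Phi>"
  using entails_iff entails_subset by blast

lemma entails_eq_consequences:
  assumes "\<Phi> \<subseteq> sdom S" "\<Psi> \<subseteq> sdom S" "consequences S \<Phi> = consequences S \<Psi>"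
  shows "entails S \<Phi> \<Psi>"
  using assms consequences_extensive by (simp add: entails_iff)

lemma entails_consequences_left: "\<Phi> \<subseteq> sdom S \<Longrightarrow> entails S (consequences S \<Phi>) \<Phi>"
  by (rule entails_subset[OF consequences_dom consequences_extensive])

lemma consequences_idem: "\<Phi> \<subseteq> sdom S \<Longrightarrow> consequences S (consequences S \<Phi>) = consequences S \<Phi>"
  by (rule consequences_eqI[OF entails_consequences_left entails_consequences])

text \<open>Entailment from a fixed set is inclusion in its closure, so it can be checked element by
  element, each element with its own premises. This suits unions and complex products, whose
  elements arise from different members.\<close>

lemma entails_pointwise:
  assumes "\<Phi> \<subseteq> sdom S" "\<And>\<psi>. \<psi> \<in> \<Psi> \<Longrightarrow> \<exists>\<Phi>' \<Psi>'. \<Phi>' \<subseteq> \<Phi> \<and> \<psi> \<in> \<Psi>' \<and> entails S \<Phi>' \<Psi>'"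
  shows "entails S \<Phi> \<Psi>"
  unfolding entails_iff[OF assms(1)]
proof
  fix \<psi> assume "\<psi> \<in> \<Psi>"
  then obtain \<Phi>' \<Psi>' where "\<Phi>' \<subseteq> \<Phi>" "\<psi> \<in> \<Psi>'" "entails S \<Phi>' \<Psi>'"
    using assms(2) by blast
  then show "\<psi> \<in> consequences S \<Phi>"
    using entails_trans[OF entails_subset[OF assms(1)]] unfolding consequences_def by blast
qed

text \<open>Substitution invariance, used for one \<sigma> at a time, derives the action on the
  closure from the action on \<Phi>. The identity lets an inner closure be inserted or dropped under
  a scalar.\<close>

lemma consequences_act:
  assumes "\<Sigma> \<subseteq> Substs (lang S)" "\<Phi> \<subseteq> sdom S"
  shows "consequences S (act \<Sigma> (consequences S \<Phi>)) = consequences S (act \<Sigma> \<Phi>)"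
proof (rule consequences_eqI)
  show "entails S (act \<Sigma> (consequences S \<Phi>)) (act \<Sigma> \<Phi>)"
    by (rule entails_subset[OF act_closed[OF assms(1) consequences_dom]])
      (use consequences_extensive[OF assms(2)] in \<open>auto simp: act_def\<close>)
  show "entails S (act \<Sigma> \<Phi>) (act \<Sigma> (consequences S \<Phi>))"
  proof (rule entails_pointwise[OF act_closed[OF assms]])
    fix \<psi> assume "\<psi> \<in> act \<Sigma> (consequences S \<Phi>)"
    then obtain \<sigma> where \<sigma>: "\<sigma> \<in> \<Sigma>" "\<psi> \<in> app_seq \<sigma> ` consequences S \<Phi>"
      unfolding act_def by blast
    then have "entails S (app_seq \<sigma> ` \<Phi>) (app_seq \<sigma> ` consequences S \<Phi>)"
      using entails_subst[OF entails_consequences[OF assms(2)]] assms(1) by blast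
    moreover have "app_seq \<sigma> ` \<Phi> \<subseteq> act \<Sigma> \<Phi>"
      using \<sigma>(1) by (auto simp: act_def)
    ultimately show "\<exists>\<Phi>' \<Psi>'. \<Phi>' \<subseteq> act \<Sigma> \<Phi> \<and> \<psi> \<in> \<Psi>' \<and> entails S \<Phi>' \<Psi>'"
      using \<sigma>(2) by blast
  qed
qed

text \<open>The analogue for joins: each closure in the family is derivable from its own member of
  the union.\<close>

lemma consequences_UN:
  assumes "\<And>i. i \<in> I \<Longrightarrow> \<Phi> i \<subseteq> sdom S"
  shows "consequences S (\<Union>i\<in>I. consequences S (\<Phi> i)) = consequences S (\<Union>i\<in>I. \<Phi> i)"
proof (rule consequences_eqI)
  show "entails S (\<Union>i\<in>I. consequences S (\<Phi> i)) (\<Union>i\<in>I. \<Phi> i)"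
    using consequences_dom consequences_extensive[OF assms] by (intro entails_subset) blast+
  show "entails S (\<Union>i\<in>I. \<Phi> i) (\<Union>i\<in>I. consequences S (\<Phi> i))"
    using entails_consequences[OF assms] assms by (intro entails_pointwise) blast+
qed

lemma closed_sequent_module_simps:
  "carrier (closed_module (sequent_module (sdom S)) (consequences S)) = consequences S ` Pow (sdom S)"
  "q \<star>\<^bsub>closed_module (sequent_module (sdom S)) (consequences S)\<^esub> x = consequences S (act q x)"
  by (simp_all add: closed_module_def sequent_module_def)

lemma closed_sequent_module_Sup:
  assumes "X \<subseteq> consequences S ` Pow (sdom S)"
  shows "\<Squnion>\<^bsub>closed_module (sequent_module (sdom S)) (consequences S)\<^esub>X = consequences S (\<Union>X)"
proof -
  have "X \<subseteq> Pow (sdom S)"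
    using assms consequences_dom by blast
  then show ?thesis
    using structural_closure_operator.closed_module_Sup[OF
        structural_closure_operator_consequences] assms
    by (simp add: closed_sequent_module_simps sequent_module_Sup)
qed

lemma closed_sequent_module_quantale_module:
  "quantale_module (subst_quantale (lang S)) (closed_module (sequent_module (sdom S)) (consequences S))"
  by (rule structural_closure_operator.closed_module_quantale_module[OF
        structural_closure_operator_consequences])

end

section \<open>The embedding induced by an interpretation\<close>

lemma interpretation_hom:
  assumes S: "deductive_system S" and E: "deductive_system E"
    and \<tau>: "language_translation (lang S) (lang E) \<tau>"
    and dom: "\<And>\<Phi>. \<Phi> \<subseteq> sdom S \<Longrightarrow> \<iota> \<Phi> \<subseteq> sdom E"
    and Union: "\<And>X. X \<subseteq> Pow (sdom S) \<Longrightarrow> \<iota> (\<Union>X) = \<Union>(\<iota> ` X)"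
    and entails: "\<And>\<Phi> \<Psi>. \<lbrakk>\<Phi> \<subseteq> sdom S; \<Psi> \<subseteq> sdom S\<rbrakk>
      \<Longrightarrow> entails S \<Phi> \<Psi> \<longleftrightarrow> entails E (\<iota> \<Phi>) (\<iota> \<Psi>)"
    and act: "\<And>\<Sigma> \<Phi>. \<lbrakk>\<Sigma> \<subseteq> Substs (lang S); \<Phi> \<subseteq> sdom S\<rbrakk>
      \<Longrightarrow> \<iota> (act \<Sigma> \<Phi>) = act (translate_substs \<tau> \<Sigma>) (\<iota> \<Phi>)"
  defines "f \<equiv> \<lambda>\<Phi>. consequences E (\<iota> \<Phi>)"
    and "M \<equiv> closed_module (sequent_module (sdom S)) (consequences S)"
    and "N \<equiv> closed_module (sequent_module (sdom E)) (consequences E)"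
  shows "qmodule_hom (subst_quantale (lang S)) M (restrict_scalars (translate_substs \<tau>) N) f"
    and "inj_on f (carrier M)"
proof -
  interpret S: deductive_system S by fact
  interpret E: deductive_system E by fact
  let ?Q = "subst_quantale (lang S)" and ?N = "restrict_scalars (translate_substs \<tau>) N"
  \<comment> \<open>A set and its closure are interderivable in \<open>S\<close>, hence their images
    under \<iota> are interderivable in \<open>E\<close>. So \<open>f\<close> absorbs the closures
    built into the joins and scalars of \<open>M\<close>.\<close>
  have f_consequences: "f (consequences S \<Phi>) = f \<Phi>" if "\<Phi> \<subseteq> sdom S" for \<Phi>
    unfolding f_def
    using S.entails_consequences[OF that] S.entails_consequences_left[OF that] that
      S.consequences_dom by (intro E.consequences_eqI) (simp_all add: entails)
  have carr_M: "carrier M = consequences S ` Pow (sdom S)"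
    by (simp add: M_def S.closed_sequent_module_simps)
  have carr_M_dom: "carrier M \<subseteq> Pow (sdom S)"
    using S.consequences_dom by (auto simp: carr_M)
  have carr_N: "carrier N = consequences E ` Pow (sdom E)"
    by (simp add: N_def E.closed_sequent_module_simps)
  show "qmodule_hom ?Q M ?N f"
  proof (intro qmodule_hom.intro qmodule_hom_axioms.intro)
    show "quantale_module ?Q M"
      unfolding M_def by (rule S.closed_sequent_module_quantale_module)
    show "quantale_module ?Q ?N"
      unfolding N_def by (rule restrict_scalars_quantale_module[OF
            quantale_hom_translate_substs[OF \<tau>] E.closed_sequent_module_quantale_module])
    show f_closed: "f \<in> carrier M \<rightarrow> carrier ?N"
      using carr_M_dom dom by (auto simp: restrict_scalars_simps carr_N f_def)
    show "f (\<Squnion>\<^bsub>M\<^esub>X) = \<Squnion>\<^bsub>?N\<^esub>(f ` X)" if "X \<subseteq> carrier M" for X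
    proof -
      have X: "X \<subseteq> Pow (sdom S)"
        using that carr_M_dom by blast
      have "f ` X \<subseteq> consequences E ` Pow (sdom E)"
        using that f_closed by (auto simp: restrict_scalars_simps carr_N)
      then have "\<Squnion>\<^bsub>?N\<^esub>(f ` X) = consequences E (\<Union>(f ` X))"
        unfolding restrict_scalars_Sup N_def by (rule E.closed_sequent_module_Sup)
      also have "\<dots> = consequences E (\<Union>(\<iota> ` X))"
        unfolding f_def by (rule E.consequences_UN) (use X dom in blast)
      also have "\<dots> = f (\<Union>X)"
        using Union[OF X] by (simp add: f_def)
      \<comment> \<open>The closure is reinserted under \<open>f\<close> to reach the join of
        \<open>M\<close>, which is the closed union.\<close>
      also have "\<dots> = f (consequences S (\<Union>X))"
        using f_consequences[of "\<Union>X"] X by blast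
      also have "consequences S (\<Union>X) = \<Squnion>\<^bsub>M\<^esub>X"
        unfolding M_def by (rule S.closed_sequent_module_Sup[symmetric]) (use that carr_M in simp)
      finally show ?thesis ..
    qed
    show "f (q \<star>\<^bsub>M\<^esub> x) = q \<star>\<^bsub>?N\<^esub> f x" if "q \<in> carrier ?Q" "x \<in> carrier M" for q x
    proof -
      have q: "q \<subseteq> Substs (lang S)" and x: "x \<subseteq> sdom S"
        using that carr_M_dom by (auto simp: subst_quantale_def)
      have "f (q \<star>\<^bsub>M\<^esub> x) = f (act q x)"
        using f_consequences[OF S.act_closed[OF q x]]
        by (simp add: M_def S.closed_sequent_module_simps)
      also have "\<dots> = consequences E (act (translate_substs \<tau> q) (\<iota> x))"
        by (simp add: f_def act[OF q x])
      \<comment> \<open>The inner closure, put back under the outer one, turns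
        \<open>\<iota> x\<close> into \<open>f x\<close>.\<close>
      also have "\<dots> = consequences E (act (translate_substs \<tau> q) (f x))"
        unfolding f_def
        using E.consequences_act[OF translate_substs_closed[OF \<tau> q] dom[OF x]] ..
      finally show ?thesis
        by (simp add: N_def restrict_scalars_simps E.closed_sequent_module_simps)
    qed
  qed
  show "inj_on f (carrier M)"
  proof (rule inj_onI)
    have cl: "consequences S x = x" if "x \<in> carrier M" for x
      using that S.consequences_idem by (auto simp: carr_M)
    fix x y assume *: "x \<in> carrier M" "y \<in> carrier M" "f x = f y"
    then have xy: "x \<subseteq> sdom S" "y \<subseteq> sdom S"
      using carr_M_dom by auto
    \<comment> \<open>Equal closures in \<open>E\<close> make \<open>\<iota> x\<close> and
      \<open>\<iota> y\<close> interderivable there; reflection of entailment brings this back to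
      \<open>S\<close>, where \<open>x\<close> and \<open>y\<close> are their own closures.\<close>
    have "entails S x y" "entails S y x"
      using xy *(3) dom by (simp_all add: entails E.entails_eq_consequences f_def)
    then show "x = y"
      using S.consequences_eqI cl *(1,2) by metis
  qed
qed

theorem theorem5p5p12:
  fixes S :: "'f dsystem" and T :: "'g dsystem"
  assumes "deductive_system S" and "deductive_system T"
    and "weakly_interpretable S T"
  shows "\<exists>h \<epsilon> f.
    quantale_hom (subst_quantale (lang S)) (subst_quantale (lang T)) h \<and>
    structural_closure_operator (subst_quantale (lang T)) (sequent_module (sdom T)) \<epsilon> \<and>
    cl_op_le (sequent_module (sdom T)) (consequences T) \<epsilon> \<and>
    qmodule_hom (subst_quantale (lang S))
      (closed_module (sequent_module (sdom S)) (consequences S))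
      (restrict_scalars h (closed_module (sequent_module (sdom T)) \<epsilon>)) f \<and>
    inj_on f (carrier (closed_module (sequent_module (sdom S)) (consequences S)))"
proof -
  obtain \<tau> E where \<tau>: "language_translation (lang S) (lang T) \<tau>"
    and ext: "extension_of E T" and int: "interpretable_via S E \<tau>"
    using assms(3) unfolding weakly_interpretable_def by blast
  have E: "deductive_system E" and eqs: "lang E = lang T" "sdom E = sdom T"
    and le: "\<And>\<Phi> \<Psi>. entails T \<Phi> \<Psi> \<Longrightarrow> entails E \<Phi> \<Psi>"
    using ext unfolding extension_of_def by blast+
  obtain \<iota> where dom: "\<iota> \<in> Pow (sdom S) \<rightarrow> Pow (sdom E)"
    and Union: "\<forall>X \<subseteq> Pow (sdom S). \<iota> (\<Union>X) = \<Union>(\<iota> ` X)"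
    and entails: "\<forall>\<Phi> \<subseteq> sdom S. \<forall>\<Psi> \<subseteq> sdom S. entails S \<Phi> \<Psi> \<longleftrightarrow> entails E (\<iota> \<Phi>) (\<iota> \<Psi>)"
    and act: "\<forall>\<Sigma> \<subseteq> Substs (lang S). \<forall>\<Phi> \<subseteq> sdom S.
      \<iota> (act \<Sigma> \<Phi>) = act (translate_substs \<tau> \<Sigma>) (\<iota> \<Phi>)"
    using int unfolding interpretable_via_def by (elim exE conjE) (rule that; assumption)
  have dom': "\<iota> \<Phi> \<subseteq> sdom E" if "\<Phi> \<subseteq> sdom S" for \<Phi>
    using dom that by blast
  have \<tau>': "language_translation (lang S) (lang E) \<tau>"
    using \<tau> eqs by simp
  show ?thesis
  \<comment> \<open>The witnesses are \<open>translate_substs \<tau>\<close>, the closure operator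
    of the extension \<open>E\<close>, and the map \<open>f\<close> of
    \<open>interpretation_hom\<close>.\<close>
  proof (intro exI conjI)
    show "quantale_hom (subst_quantale (lang S)) (subst_quantale (lang T)) (translate_substs \<tau>)"
      by (rule quantale_hom_translate_substs[OF \<tau>])
    show "structural_closure_operator (subst_quantale (lang T)) (sequent_module (sdom T))
        (consequences E)"
      using deductive_system.structural_closure_operator_consequences[OF E] by (simp add: eqs)
    \<comment> \<open>A stronger consequence relation has a pointwise larger closure
      operator.\<close>
    show "cl_op_le (sequent_module (sdom T)) (consequences T) (consequences E)"
      using le by (auto simp: cl_op_le_def sequent_module_def consequences_def)
  qed (use interpretation_hom[OF assms(1) E \<tau>' dom' Union[rule_format] entails[rule_format]
        act[rule_format]] in \<open>simp_all add: eqs\<close>)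
qed

end
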